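(* Let $0<\sigma_{\min}<1$ and let $h\in C^1(\mathbb{R})$ satisfy, for all $t\in\mathbb{R}$, $|h(t)|\le \frac{\psi_h(t)}{1+|t|}$ and $|h'(t)|\le\frac{\varphi_h(t)}{1+t^2}$, where $\psi_h,\varphi_h$ are continuous, non-negative and bounded functions on $\mathbb{R}$. Let $f\in L^2(\mathbb{R})$ with associated focus function $\sigma_f\in\Phi_{\sigma_{\min}}$, let $\varepsilon>0$, and let $\sigma_\varepsilon\in\Phi_{\sigma_{\min}}$ be such that $\|\sigma_f-\sigma_\varepsilon\|_\infty\le\varepsilon$. Then $$\|\mathcal{L}_{\sigma_\varepsilon}f-Mf\|_{L^2(\mathbb{R}^2)}\le\varepsilon\,C_1'(h,\sigma_f)\,\|f\|_2,$$ where $$C_1'(h,\sigma_f)=\frac{\sqrt2}{2}\,\frac{\|\psi_h\|_\infty}{\sigma_{\min}}+\sqrt{\frac{\pi}{2}}\,\frac{\|\varphi_h\|_\infty}{\sigma_{\min}^{3/2}}\,\|\sigma_f\|_\infty^{1/2}.$$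
   Context: For $0<\sigma_{\min}<1$, $\Phi_{\sigma_{\min}}$ denotes the class of continuous functions $\sigma:\mathbb{R}\to\mathbb{R}$ with $\sigma(t)\ge\sigma_{\min}$ for all $t$ and $\sigma(t)\to1$ as $t\to\pm\infty$. For $\sigma\in\Phi_{\sigma_{\min}}$, a window $h$, and $t,\omega\in\mathbb{R}$, put $h_{t,\omega,\sigma}(x)=\sqrt{\sigma(t)}\,e^{2i\pi\omega x}\,h(\sigma(t)(x-t))$, and for $f\in L^2(\mathbb{R})$ put $\mathcal{L}_\sigma f(t,\omega)=\langle f,h_{t,\omega,\sigma}\rangle$, where $\langle f,g\rangle=\int_{\mathbb{R}}f\,\overline{g}$ is the $L^2(\mathbb{R})$ inner product. It is assumed that a (possibly non-linear) mapping $f\mapsto\sigma_f\in\Phi_{\sigma_{\min}}$ is given on $L^2(\mathbb{R})$; the non-linear time-focused transform is $Mf(t,\omega)=\langle f,h_{t,\omega,\sigma_f}\rangle$, i.e. $Mf=\mathcal{L}_{\sigma_f}f$. $\|\cdot\|_p$ is the $L^p(\mathbb{R})$ norm. *)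

theory Defs
  imports "HOL-Analysis.Analysis" "HOL-Probability.Essential_Supremum"
begin

text \<open>
  Elements of \<open>L\<^sup>2\<close> are represented by functions, not by classes modulo null sets.
\<close>

definition L2_space :: "'a measure \<Rightarrow> ('a \<Rightarrow> complex) set" where
  "L2_space M = {f \<in> borel_measurable M. integrable M (\<lambda>x. (cmod (f x))\<^sup>2)}"

text \<open>The Bochner integral is 0 off its domain, so this is the norm only on \<^const>\<open>L2_space\<close>.\<close>

definition L2_norm :: "'a measure \<Rightarrow> ('a \<Rightarrow> complex) \<Rightarrow> real" where
  "L2_norm M f = sqrt (LINT x|M. (cmod (f x))\<^sup>2)"

definition L2_inner :: "(real \<Rightarrow> complex) \<Rightarrow> (real \<Rightarrow> complex) \<Rightarrow> complex" where
  "L2_inner f g = (LINT x|lebesgue. f x * cnj (g x))"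

text \<open>Like \<^const>\<open>L2_norm\<close>, this is meaningful only for essentially bounded functions.\<close>

definition Linf_norm :: "(real \<Rightarrow> real) \<Rightarrow> real" where
  "Linf_norm g = real_of_ereal (esssup lebesgue (\<lambda>t. ereal \<bar>g t\<bar>))"

definition focus_class :: "real \<Rightarrow> (real \<Rightarrow> real) set" where
  "focus_class \<sigma>min =
     {\<sigma>. continuous_on UNIV \<sigma> \<and> (\<forall>t. \<sigma>min \<le> \<sigma> t) \<and>
         (\<sigma> \<longlongrightarrow> 1) at_top \<and> (\<sigma> \<longlongrightarrow> 1) at_bot}"

definition focus_atom ::
  "(real \<Rightarrow> complex) \<Rightarrow> (real \<Rightarrow> real) \<Rightarrow> real \<Rightarrow> real \<Rightarrow> real \<Rightarrow> complex" where
  "focus_atom h \<sigma> t \<omega> x =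
     of_real (sqrt (\<sigma> t)) * exp (2 * \<i> * of_real pi * of_real \<omega> * of_real x) * h (\<sigma> t * (x - t))"

definition focus_transform ::
  "(real \<Rightarrow> complex) \<Rightarrow> (real \<Rightarrow> real) \<Rightarrow> (real \<Rightarrow> complex) \<Rightarrow> real \<Rightarrow> real \<Rightarrow> complex" where
  "focus_transform h \<sigma> f t \<omega> = L2_inner f (focus_atom h \<sigma> t \<omega>)"

definition nonlinear_focus_transform ::
  "(real \<Rightarrow> complex) \<Rightarrow> ((real \<Rightarrow> complex) \<Rightarrow> real \<Rightarrow> real) \<Rightarrow>
   (real \<Rightarrow> complex) \<Rightarrow> real \<Rightarrow> real \<Rightarrow> complex" where
  "nonlinear_focus_transform h focus f = focus_transform h (focus f) f"

definition C1_const ::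
  "real \<Rightarrow> (real \<Rightarrow> real) \<Rightarrow> (real \<Rightarrow> real) \<Rightarrow> (real \<Rightarrow> real) \<Rightarrow> real" where
  "C1_const \<sigma>min \<psi> \<phi> \<sigma> =
     sqrt 2 / 2 * (Linf_norm \<psi> / \<sigma>min) +
     sqrt (pi / 2) * (Linf_norm \<phi> / \<sigma>min powr (3 / 2)) * Linf_norm \<sigma> powr (1 / 2)"

end

theory Submission
  imports Defs "HOL-Probability.Characteristic_Functions" "HOL-Real_Asymp.Real_Asymp"
begin

text \<open>
  Only the inequality half of Plancherel's theorem is needed: for integrable \<open>g\<close>, weighting the squared
  modulus of its Fourier transform by a Gaussian and applying Fubini gives a quadratic form in \<open>g\<close> whose
  kernel is a probability density, bounded by the squared \<open>L\<^sup>2\<close> norm of \<open>g\<close>; then the Gaussian widens to 1.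
  For fixed \<open>t\<close> the difference of the two transforms is the Fourier transform of \<open>f\<close> times the difference
  of the two dilated windows, so by Tonelli it remains to integrate the squared window difference
  over \<open>t\<close>, for fixed \<open>x\<close>. Splitting that difference into a change of amplitude and a change of scale
  (mean value theorem for \<open>h\<close>) gives the two summands of the constant.
\<close>

section \<open>Measurable representatives, essential suprema and bounded focus functions\<close>

lemma borel_measurable_cnj [measurable]: "cnj \<in> borel_measurable borel"
  by (intro borel_measurable_continuous_onI continuous_intros)

text \<open>Elements of \<open>L2_space lebesgue\<close> are only Lebesgue measurable, whereas the
  Fubini arguments below run on products of \<open>lborel\<close> and want Borel functions. Real and
  imaginary parts are replaced separately, since \<open>completion_ex_borel_measurable_real\<close>
  treats real functions.\<close>

lemma lebesgue_ex_borel_representative: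
  fixes f :: "real \<Rightarrow> complex"
  assumes "f \<in> borel_measurable lebesgue"
  obtains g where "g \<in> borel_measurable borel" "AE x in lborel. f x = g x"
proof -
  have "(\<lambda>x. Re (f x)) \<in> borel_measurable lebesgue" "(\<lambda>x. Im (f x)) \<in> borel_measurable lebesgue"
    using assms by measurable
  from this[THEN completion_ex_borel_measurable_real] obtain u v
    where uv: "u \<in> borel_measurable lborel" "v \<in> borel_measurable lborel"
      "AE x in lborel. Re (f x) = u x" "AE x in lborel. Im (f x) = v x"
    by blast
  show thesis
  proof
    show "(\<lambda>x. Complex (u x) (v x)) \<in> borel_measurable borel"
      using uv by (simp add: borel_measurable_complex_iff)
    show "AE x in lborel. f x = Complex (u x) (v x)"
      using uv(3,4) by eventually_elim (simp add: complex_eq_iff)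
  qed
qed

text \<open>For continuous \<open>g\<close> the set where \<open>\<bar>g t\<bar>\<close> stays below
  the essential supremum is closed and has full measure, so it is the whole line. Boundedness keeps
  the supremum finite; \<open>real_of_ereal\<close> would send infinity to 0. This turns every
  sup-norm in the theorem into a pointwise bound.\<close>

lemma abs_le_Linf_norm:
  assumes cont: "continuous_on UNIV g" and bdd: "bounded (range g)"
  shows "\<bar>g t\<bar> \<le> Linf_norm g"
proof -
  let ?e = "esssup lebesgue (\<lambda>t. ereal \<bar>g t\<bar>)"
  have [measurable]: "g \<in> borel_measurable borel"
    using cont by (rule borel_measurable_continuous_onI)
  obtain B where B: "\<And>x. \<bar>g x\<bar> \<le> B"
    using bdd by (auto simp: bounded_iff)
  have "?e \<le> ereal B"
    using B by (intro esssup_I borel_measurable_ereal) (auto intro!: measurable_completion)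
  moreover have "ereal \<bar>g t\<bar> \<le> ?e"
  proof -
    have "closed {t. ereal \<bar>g t\<bar> \<le> ?e}"
      by (intro closed_Collect_le continuous_intros cont)
    moreover have "AE t in lebesgue. t \<in> {t. ereal \<bar>g t\<bar> \<le> ?e}"
      using esssup_AE by auto
    ultimately show ?thesis
      using mem_closed_if_AE_lebesgue by blast
  qed
  ultimately show ?thesis
    unfolding Linf_norm_def by (cases ?e) auto
qed

text \<open>Outside a compact interval both limits force the values into \<open>ball 1 1\<close>,
  and on the interval continuity gives a bounded image. If \<open>b < a\<close> the interval is
  empty and the two rays already cover the line.\<close>

lemma bounded_range_focus_class:
  assumes "\<sigma> \<in> focus_class m"
  shows "bounded (range \<sigma>)"
proof -
  have cont: "continuous_on UNIV \<sigma>" and top: "(\<sigma> \<longlongrightarrow> 1) at_top" and bot: "(\<sigma> \<longlongrightarrow> 1) at_bot"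
    using assms by (auto simp: focus_class_def)
  obtain b where b: "\<And>t. t \<ge> b \<Longrightarrow> dist (\<sigma> t) 1 < 1"
    using tendstoD[OF top, of 1] by (auto simp: eventually_at_top_linorder)
  obtain a where a: "\<And>t. t \<le> a \<Longrightarrow> dist (\<sigma> t) 1 < 1"
    using tendstoD[OF bot, of 1] by (auto simp: eventually_at_bot_linorder)
  have "bounded (\<sigma> ` {a..b} \<union> ball 1 1)"
    by (intro bounded_Un[THEN iffD2] conjI compact_imp_bounded compact_continuous_image
        continuous_on_subset[OF cont] bounded_ball) auto
  moreover have "range \<sigma> \<subseteq> \<sigma> ` {a..b} \<union> ball 1 1"
  proof (intro image_subsetI)
    fix t show "\<sigma> t \<in> \<sigma> ` {a..b} \<union> ball 1 1"
      using a[of t] b[of t] by (cases "a \<le> t"; cases "t \<le> b") (auto simp: dist_commute)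
  qed
  ultimately show ?thesis
    using bounded_subset by blast
qed

section \<open>Integral tools and two explicit integrals\<close>

lemma ennreal_norm_integral_le:
  fixes f :: "'a \<Rightarrow> 'b::{banach, second_countable_topology}"
  shows "ennreal (norm (integral\<^sup>L M f)) \<le> (\<integral>\<^sup>+x. ennreal (norm (f x)) \<partial>M)"
  \<comment> \<open>A non-integrable function has Bochner integral 0 by convention, so the bound is
    trivial in that case.\<close>
  by (cases "integrable M f") (auto simp: integral_norm_bound_ennreal not_integrable_integral_eq)

lemma nn_integral_lborel_reflect:
  fixes f :: "real \<Rightarrow> ennreal"
  assumes "f \<in> borel_measurable borel"
  shows "(\<integral>\<^sup>+y. f (x - y) \<partial>lborel) = (\<integral>\<^sup>+y. f y \<partial>lborel)"
  using nn_integral_real_affine[of f "-1" x] assms by simp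

lemma nn_integral_FTC_even:
  fixes f F :: "real \<Rightarrow> real"
  assumes f[measurable]: "f \<in> borel_measurable borel"
    and F: "\<And>x. 0 \<le> x \<Longrightarrow> (F has_real_derivative f x) (at x)"
    and nonneg: "\<And>x. 0 \<le> f x"
    and even: "\<And>x. f (- x) = f x"
    and lim: "(F \<longlongrightarrow> T) at_top"
  shows "(\<integral>\<^sup>+x. f x \<partial>lborel) = ennreal (2 * (T - F 0))"
proof -
  have *: "(\<integral>\<^sup>+x. ennreal (f x) * indicator {0..} x \<partial>lborel) = T - F 0"
    by (rule nn_integral_FTC_atLeast[OF f F nonneg lim])
  \<comment> \<open>The sign of \<open>T - F 0\<close> is needed to read the extended integral as a
    Bochner integral, the form in which the doubling rule for even functions applies.\<close>
  have "F 0 \<le> F x" if "0 \<le> x" for x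
    using that F nonneg by (intro DERIV_nonneg_imp_nondecreasing[of 0 x F]) auto
  then have "F 0 \<le> T"
    by (intro tendsto_lowerbound[OF lim] eventually_mono[OF eventually_ge_at_top[of 0]]) auto
  have "has_bochner_integral lborel (\<lambda>x. indicator {0..} x *\<^sub>R f x) (T - F 0)"
    using * nonneg \<open>F 0 \<le> T\<close>
    by (intro has_bochner_integral_nn_integral)
       (auto simp: ennreal_mult ennreal_indicator mult.commute)
  then have "has_bochner_integral lborel f (2 *\<^sub>R (T - F 0))"
    by (rule has_bochner_integral_even_function) (rule even)
  then show ?thesis
    using nonneg by (simp add: has_bochner_integral_iff nn_integral_eq_integral)
qed

lemma nn_integral_inverse_abs_square:
  fixes m :: real
  assumes m: "0 < m"
  shows "(\<integral>\<^sup>+x. (1 / (1 + m * \<bar>x\<bar>))\<^sup>2 \<partial>lborel) = ennreal (2 / m)"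
proof -
  \<comment> \<open>The value is left as twice limit minus initial value of the antiderivative, to
    match the rule.\<close>
  have "(\<integral>\<^sup>+x. (1 / (1 + m * \<bar>x\<bar>))\<^sup>2 \<partial>lborel) = ennreal (2 * (0 - (- 1 / (m * (1 + m * 0)))))"
  proof (rule nn_integral_FTC_even[where F = "\<lambda>x. - 1 / (m * (1 + m * x))"])
    show "((\<lambda>x. - 1 / (m * (1 + m * x))) has_real_derivative (1 / (1 + m * \<bar>x\<bar>))\<^sup>2) (at x)"
      if "0 \<le> x" for x
    proof -
      have "1 + m * x \<noteq> 0"
        using that m by (smt (verit) mult_nonneg_nonneg)
      then have "((\<lambda>x. - (1 / m) * inverse (1 + m * x)) has_real_derivative
          - (1 / m) * - (inverse (1 + m * x) * m * inverse (1 + m * x))) (at x)"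
        by (auto intro!: derivative_eq_intros)
      moreover have "- (1 / m) * - (inverse (1 + m * x) * m * inverse (1 + m * x)) = (1 / (1 + m * \<bar>x\<bar>))\<^sup>2"
        using m that by (simp add: power2_eq_square inverse_eq_divide)
      moreover have "(\<lambda>x. - (1 / m) * inverse (1 + m * x)) = (\<lambda>x. - 1 / (m * (1 + m * x)))"
        by (simp add: fun_eq_iff inverse_eq_divide)
      ultimately show ?thesis
        by metis
    qed
    show "((\<lambda>x. - 1 / (m * (1 + m * x))) \<longlongrightarrow> 0) at_top"
      using m by real_asymp
  qed auto
  then show ?thesis by simp
qed

text \<open>Integrating \<open>x * (x / (1 + m\<^sup>2 * x\<^sup>2)\<^sup>2)\<close> by parts gives
  the antiderivative \<open>?F\<close>, whose arctangent contributes the factor pi. This integral is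
  the source of the factor \<open>sqrt (pi / 2)\<close> and the exponent 3/2 in
  \<open>C1_const\<close>.\<close>

lemma nn_integral_abs_over_quadratic_square:
  fixes m :: real
  assumes m: "0 < m"
  shows "(\<integral>\<^sup>+x. (\<bar>x\<bar> / (1 + m\<^sup>2 * x\<^sup>2))\<^sup>2 \<partial>lborel) = ennreal (pi / (2 * m ^ 3))"
proof -
  let ?F = "\<lambda>x. (arctan (m * x) - m * x / (1 + m\<^sup>2 * x\<^sup>2)) / (2 * m ^ 3)"
  have "(\<integral>\<^sup>+x. (\<bar>x\<bar> / (1 + m\<^sup>2 * x\<^sup>2))\<^sup>2 \<partial>lborel) = ennreal (2 * ((pi / 2 - 0) / (2 * m ^ 3) - ?F 0))"
  proof (rule nn_integral_FTC_even[where F = ?F])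
    show "(?F has_real_derivative (\<bar>x\<bar> / (1 + m\<^sup>2 * x\<^sup>2))\<^sup>2) (at x)" for x
    proof -
      define q where "q = 1 + m\<^sup>2 * x\<^sup>2"
      have q: "q > 0"
        by (simp add: q_def add_pos_nonneg)
      have "(?F has_real_derivative
          (inverse (1 + (m * x)\<^sup>2) * m - (m * q - m * x * (m\<^sup>2 * (2 * x))) / (q * q)) / (2 * m ^ 3)) (at x)"
        using q m unfolding q_def
        by (intro DERIV_cdivide DERIV_diff DERIV_divide)
           (auto intro!: derivative_eq_intros)
      \<comment> \<open>Over the common denominator \<open>q * q\<close> the terms
        \<open>m * q\<close> cancel, leaving the numerator
        \<open>2 * m ^ 3 * x\<^sup>2\<close>.\<close>
      moreover have "inverse (1 + (m * x)\<^sup>2) * m = m * q / (q * q)"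
        using q by (simp add: q_def power_mult_distrib inverse_eq_divide)
      moreover have "(m * q / (q * q) - (m * q - m * x * (m\<^sup>2 * (2 * x))) / (q * q)) / (2 * m ^ 3) = (\<bar>x\<bar> / q)\<^sup>2"
        unfolding diff_divide_distrib[symmetric] power_divide
        using m by (simp add: power2_eq_square power3_eq_cube)
      ultimately show ?thesis
        by (simp add: q_def)
    qed
    have "filterlim (\<lambda>x. m * x) at_top at_top"
      using m by real_asymp
    then have "((\<lambda>x. arctan (m * x)) \<longlongrightarrow> pi / 2) at_top"
      by (rule filterlim_compose[OF tendsto_arctan_at_top])
    moreover have "((\<lambda>x. m * x / (1 + m\<^sup>2 * x\<^sup>2)) \<longlongrightarrow> 0) at_top"
      using m by real_asymp
    ultimately show "(?F \<longlongrightarrow> (pi / 2 - 0) / (2 * m ^ 3)) at_top"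
      using m by (intro tendsto_intros) auto
  qed auto
  then show ?thesis by simp
qed

section \<open>The Plancherel inequality via Gaussian damping\<close>

lemma integral_gaussian_iexp:
  fixes s z :: real
  assumes s: "0 < s"
  shows "(CLINT \<omega>|lborel. of_real (exp (- \<omega>\<^sup>2 / (2 * s\<^sup>2))) * iexp (2 * pi * \<omega> * z))
    = of_real (normal_density 0 (1 / (2 * pi * s)) z)"
proof -
  \<comment> \<open>The transform of a Gaussian is the characteristic function of the standard
    normal law; the substitution \<omega> = s x below reduces the general width to it.\<close>
  have char: "(CLINT x|lborel. std_normal_density x *\<^sub>R iexp (t * x)) = of_real (exp (- t\<^sup>2 / 2))" for t
    using fun_cong[OF char_std_normal_distribution, of t]
    by (simp add: char_def integral_density normal_density_nonneg)
  have "(CLINT \<omega>|lborel. of_real (exp (- \<omega>\<^sup>2 / (2 * s\<^sup>2))) * iexp (2 * pi * \<omega> * z))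
    = \<bar>s\<bar> *\<^sub>R (CLINT x|lborel. of_real (exp (- (0 + s * x)\<^sup>2 / (2 * s\<^sup>2))) * iexp (2 * pi * (0 + s * x) * z))"
    using s by (subst lborel_integral_real_affine[where c = s and t = 0]) auto
  also have "(CLINT x|lborel. of_real (exp (- (0 + s * x)\<^sup>2 / (2 * s\<^sup>2))) * iexp (2 * pi * (0 + s * x) * z))
    = (CLINT x|lborel. sqrt (2 * pi) *\<^sub>R (std_normal_density x *\<^sub>R iexp ((2 * pi * s * z) * x)))"
    using s by (intro Bochner_Integration.integral_cong)
       (auto simp: std_normal_density_def scaleR_conv_of_real power_mult_distrib ac_simps)
  also have "\<dots> = sqrt (2 * pi) *\<^sub>R of_real (exp (- (2 * pi * s * z)\<^sup>2 / 2))"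
    by (simp only: integral_scaleR_right char)
  also have "\<bar>s\<bar> *\<^sub>R \<dots> = complex_of_real (s * sqrt (2 * pi) * exp (- (2 * pi * s * z)\<^sup>2 / 2))"
    using s by (simp add: scaleR_conv_of_real)
  \<comment> \<open>The prefactor is exactly the normalising constant for standard deviation
    \<open>1 / (2 * pi * s)\<close>, so the kernel has total mass 1.\<close>
  also have "s * sqrt (2 * pi) * exp (- (2 * pi * s * z)\<^sup>2 / 2) = normal_density 0 (1 / (2 * pi * s)) z"
  proof -
    have "1 / sqrt (2 * pi * (1 / (2 * pi * s))\<^sup>2) = s * sqrt (2 * pi)"
    proof -
      have "2 * pi * (1 / (2 * pi * s))\<^sup>2 = 1 / (s\<^sup>2 * (2 * pi))"
        using s by (simp add: power2_eq_square field_simps)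
      then show ?thesis
        using s by (simp add: real_sqrt_divide real_sqrt_mult)
    qed
    moreover have "- (z - 0)\<^sup>2 / (2 * (1 / (2 * pi * s))\<^sup>2) = - (2 * pi * s * z)\<^sup>2 / 2"
      using s by (simp add: power2_eq_square field_simps)
    ultimately show ?thesis
      unfolding normal_density_def by simp
  qed
  finally show ?thesis .
qed

text \<open>Provides the product majorants for the two exchanges of integration in
  \<open>nn_integral_fourier_gaussian_le\<close>.\<close>

lemma integrable_lborel_pair_mult:
  fixes u :: "real \<Rightarrow> real" and v :: "real \<Rightarrow> real"
  assumes u: "integrable lborel u" and v: "integrable lborel v"
  shows "integrable (lborel \<Otimes>\<^sub>M lborel) (\<lambda>(x, y). u x * v y)"
proof (rule lborel_pair.Fubini_integrable)
  have [measurable]: "u \<in> borel_measurable borel" "v \<in> borel_measurable borel"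
    using borel_measurable_integrable[OF u] borel_measurable_integrable[OF v] by auto
  show "(\<lambda>(x, y). u x * v y) \<in> borel_measurable (lborel \<Otimes>\<^sub>M lborel)"
    by measurable
  show "integrable lborel (\<lambda>x. LINT y|lborel. norm (case (x, y) of (x, y) \<Rightarrow> u x * v y))"
    using u by (simp add: abs_mult)
  show "AE x in lborel. integrable lborel (\<lambda>y. case (x, y) of (x, y) \<Rightarrow> u x * v y)"
    using v by simp
qed

text \<open>With 2 pi in the exponent Plancherel has constant 1, and the sign is that of the
  conjugated modulation in \<open>focus_atom\<close>.\<close>

definition fourier :: "(real \<Rightarrow> complex) \<Rightarrow> real \<Rightarrow> complex" where
  "fourier g \<omega> = (CLINT x|lborel. g x * iexp (- (2 * pi * \<omega> * x)))"

lemma borel_measurable_fourier [measurable]: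
  assumes [measurable]: "g \<in> borel_measurable borel"
  shows "fourier g \<in> borel_measurable borel"
  unfolding fourier_def by measurable

lemma norm_fourier_le:
  assumes "integrable lborel g"
  shows "norm (fourier g \<omega>) \<le> (LINT x|lborel. norm (g x))"
proof -
  have "norm (fourier g \<omega>) \<le> (LINT x|lborel. norm (g x * iexp (- (2 * pi * \<omega> * x))))"
    unfolding fourier_def by (rule integral_norm_bound)
  then show ?thesis
    by (simp add: norm_mult)
qed

text \<open>The right side may be infinite, so the final estimates are made in extended nonnegative
  reals; the damping makes the left side finite and Fubini applicable.\<close>

lemma nn_integral_fourier_gaussian_le:
  fixes g :: "real \<Rightarrow> complex"
  assumes g: "integrable lborel g" and s: "0 < s"
  shows "(\<integral>\<^sup>+\<omega>. ennreal (exp (- \<omega>\<^sup>2 / (2 * s\<^sup>2)) * (norm (fourier g \<omega>))\<^sup>2) \<partial>lborel)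
    \<le> (\<integral>\<^sup>+x. ennreal ((norm (g x))\<^sup>2) \<partial>lborel)"
proof -
  define w where "w = (\<lambda>\<omega>::real. exp (- \<omega>\<^sup>2 / (2 * s\<^sup>2)))"
  define G where "G = normal_density 0 (1 / (2 * pi * s))"
  define B where "B = (LINT x|lborel. norm (g x))"
  have [measurable]: "g \<in> borel_measurable borel"
    using borel_measurable_integrable[OF g] by auto
  have [measurable]: "w \<in> borel_measurable borel" "G \<in> borel_measurable borel"
    by (auto simp: w_def G_def)
  have G_nonneg: "0 \<le> G z" and G_even: "G (x - y) = G (y - x)" for x y z
    by (auto simp: G_def normal_density_def power2_commute)
  have G_int: "(\<integral>\<^sup>+y. G (x - y) \<partial>lborel) = 1" for x
  proof -
    have "(\<integral>\<^sup>+y. G y \<partial>lborel) = 1"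
      using s by (subst nn_integral_eq_integral) (auto simp: G_def G_nonneg)
    then show ?thesis
      using nn_integral_lborel_reflect[of "\<lambda>y. ennreal (G y)" x] by simp
  qed
  have w_int: "integrable lborel w"
  proof -
    have "w = (\<lambda>\<omega>. sqrt (2 * pi * s\<^sup>2) * normal_density 0 s \<omega>)"
      using s by (auto simp: w_def normal_density_def fun_eq_iff)
    moreover have "integrable lborel (\<lambda>\<omega>. sqrt (2 * pi * s\<^sup>2) * normal_density 0 s \<omega>)"
      using s by simp
    ultimately show ?thesis by simp
  qed
  have FB: "norm (fourier g \<omega>) \<le> B" for \<omega>
    unfolding B_def by (rule norm_fourier_le[OF g])
  have B0: "0 \<le> B"
    by (simp add: B_def)

  \<comment> \<open>Inverting the damped transform yields the convolution of \<open>g\<close> with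
    \<open>G\<close>.\<close>
  have step1: "(CLINT \<omega>|lborel. of_real (w \<omega>) * fourier g \<omega> * iexp (2 * pi * \<omega> * x))
      = (CLINT y|lborel. g y * of_real (G (x - y)))" for x
  proof -
    have int: "integrable (lborel \<Otimes>\<^sub>M lborel)
        (\<lambda>(\<omega>, y). of_real (w \<omega>) * g y * iexp (2 * pi * \<omega> * (x - y)))"
      by (rule Bochner_Integration.integrable_bound
            [OF integrable_lborel_pair_mult[OF w_int integrable_norm[OF g]]])
         (auto simp: norm_mult)
    have "(CLINT \<omega>|lborel. of_real (w \<omega>) * fourier g \<omega> * iexp (2 * pi * \<omega> * x))
        = (CLINT \<omega>|lborel. (CLINT y|lborel. of_real (w \<omega>) * g y * iexp (2 * pi * \<omega> * (x - y))))"
    proof (intro Bochner_Integration.integral_cong refl)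
      fix \<omega>
      have "(CLINT y|lborel. of_real (w \<omega>) * g y * iexp (2 * pi * \<omega> * (x - y)))
        = (CLINT y|lborel. (of_real (w \<omega>) * iexp (2 * pi * \<omega> * x)) * (g y * iexp (- (2 * pi * \<omega> * y))))"
        by (intro Bochner_Integration.integral_cong)
           (auto simp: exp_add[symmetric] right_diff_distrib exp_diff exp_minus field_simps)
      then show "of_real (w \<omega>) * fourier g \<omega> * iexp (2 * pi * \<omega> * x)
        = (CLINT y|lborel. of_real (w \<omega>) * g y * iexp (2 * pi * \<omega> * (x - y)))"
        by (simp add: fourier_def)
    qed
    also have "\<dots> = (CLINT y|lborel. (CLINT \<omega>|lborel. of_real (w \<omega>) * g y * iexp (2 * pi * \<omega> * (x - y))))"
      by (rule lborel_pair.Fubini_integral[OF int, symmetric])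
    also have "\<dots> = (CLINT y|lborel. g y * of_real (G (x - y)))"
    proof (intro Bochner_Integration.integral_cong refl)
      fix y
      have "(CLINT \<omega>|lborel. of_real (w \<omega>) * g y * iexp (2 * pi * \<omega> * (x - y)))
        = (CLINT \<omega>|lborel. g y * (of_real (w \<omega>) * iexp (2 * pi * \<omega> * (x - y))))"
        by (intro Bochner_Integration.integral_cong) auto
      also have "\<dots> = g y * of_real (G (x - y))"
        using integral_gaussian_iexp[OF s, of "x - y"] by (simp add: w_def G_def)
      finally show "(CLINT \<omega>|lborel. of_real (w \<omega>) * g y * iexp (2 * pi * \<omega> * (x - y)))
        = g y * of_real (G (x - y))" .
    qed
    finally show ?thesis .
  qed

  \<comment> \<open>One factor of the squared modulus is unfolded as an integral over x while the
    other stays conjugated; after the exchange the inner integral is the one evaluated by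
    \<open>step1\<close>.\<close>
  have step2: "(CLINT \<omega>|lborel. of_real (w \<omega> * (norm (fourier g \<omega>))\<^sup>2))
      = (CLINT x|lborel. g x * cnj (CLINT y|lborel. g y * of_real (G (x - y))))"
  proof -
    have int: "integrable (lborel \<Otimes>\<^sub>M lborel)
        (\<lambda>(\<omega>, x). g x * cnj (of_real (w \<omega>) * fourier g \<omega> * iexp (2 * pi * \<omega> * x)))"
    proof (rule Bochner_Integration.integrable_bound)
      show "integrable (lborel \<Otimes>\<^sub>M lborel) (\<lambda>(\<omega>, x). (B * w \<omega>) * norm (g x))"
        using g w_int by (intro integrable_lborel_pair_mult) auto
      show "AE p in lborel \<Otimes>\<^sub>M lborel.
          norm (case p of (\<omega>, x) \<Rightarrow> g x * cnj (of_real (w \<omega>) * fourier g \<omega> * iexp (2 * pi * \<omega> * x)))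
          \<le> norm (case p of (\<omega>, x) \<Rightarrow> (B * w \<omega>) * norm (g x))"
      proof (intro AE_I2, clarify)
        fix \<omega> x
        have "norm (g x * cnj (of_real (w \<omega>) * fourier g \<omega> * iexp (2 * pi * \<omega> * x)))
            = norm (g x) * \<bar>w \<omega>\<bar> * norm (fourier g \<omega>)"
          unfolding norm_mult complex_mod_cnj norm_exp_i_times norm_of_real by simp
        also have "\<dots> \<le> norm (g x) * \<bar>w \<omega>\<bar> * B"
          using FB by (intro mult_left_mono) auto
        also have "\<dots> = norm ((B * w \<omega>) * norm (g x))"
          using B0 by (simp add: abs_mult)
        finally show "norm (g x * cnj (of_real (w \<omega>) * fourier g \<omega> * iexp (2 * pi * \<omega> * x)))
            \<le> norm ((B * w \<omega>) * norm (g x))" .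
      qed
    qed measurable
    have "(CLINT \<omega>|lborel. of_real (w \<omega> * (norm (fourier g \<omega>))\<^sup>2))
      = (CLINT \<omega>|lborel. (CLINT x|lborel. g x * cnj (of_real (w \<omega>) * fourier g \<omega> * iexp (2 * pi * \<omega> * x))))"
    proof (intro Bochner_Integration.integral_cong refl)
      fix \<omega>
      have "(CLINT x|lborel. g x * cnj (of_real (w \<omega>) * fourier g \<omega> * iexp (2 * pi * \<omega> * x)))
        = (CLINT x|lborel. (of_real (w \<omega>) * cnj (fourier g \<omega>)) * (g x * iexp (- (2 * pi * \<omega> * x))))"
        by (intro Bochner_Integration.integral_cong) (auto simp: exp_cnj)
      also have "\<dots> = of_real (w \<omega>) * cnj (fourier g \<omega>) * fourier g \<omega>"
        by (simp add: fourier_def)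
      also have "\<dots> = of_real (w \<omega> * (norm (fourier g \<omega>))\<^sup>2)"
        using complex_norm_square[of "fourier g \<omega>"] by (simp add: ac_simps)
      finally show "of_real (w \<omega> * (norm (fourier g \<omega>))\<^sup>2)
        = (CLINT x|lborel. g x * cnj (of_real (w \<omega>) * fourier g \<omega> * iexp (2 * pi * \<omega> * x)))" ..
    qed
    also have "\<dots> = (CLINT x|lborel. (CLINT \<omega>|lborel. g x * cnj (of_real (w \<omega>) * fourier g \<omega> * iexp (2 * pi * \<omega> * x))))"
      by (rule lborel_pair.Fubini_integral[OF int, symmetric])
    also have "\<dots> = (CLINT x|lborel. g x * cnj (CLINT y|lborel. g y * of_real (G (x - y))))"
      by (simp only: integral_mult_right_zero Bochner_Integration.integral_cnj step1)
    finally show ?thesis .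
  qed

  \<comment> \<open>A bounded transform against an integrable weight is integrable, so the extended
    integral equals the Bochner integral in \<open>step2\<close>.\<close>
  have "integrable lborel (\<lambda>\<omega>. w \<omega> * (norm (fourier g \<omega>))\<^sup>2)"
  proof (rule Bochner_Integration.integrable_bound)
    show "integrable lborel (\<lambda>\<omega>. B\<^sup>2 * w \<omega>)"
      using w_int by simp
    show "AE \<omega> in lborel. norm (w \<omega> * (norm (fourier g \<omega>))\<^sup>2) \<le> norm (B\<^sup>2 * w \<omega>)"
      using FB by (auto simp: abs_mult mult.commute[of "B\<^sup>2"] intro!: mult_left_mono power_mono)
  qed measurable
  then have "(\<integral>\<^sup>+\<omega>. ennreal (w \<omega> * (norm (fourier g \<omega>))\<^sup>2) \<partial>lborel)
      = ennreal (LINT \<omega>|lborel. w \<omega> * (norm (fourier g \<omega>))\<^sup>2)"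
    by (intro nn_integral_eq_integral) (auto simp: w_def)
  also have "\<dots> \<le> ennreal (norm (CLINT x|lborel. g x * cnj (CLINT y|lborel. g y * of_real (G (x - y)))))"
    unfolding step2[symmetric] integral_complex_of_real norm_of_real by (intro ennreal_leI abs_ge_self)
  also have "\<dots> \<le> (\<integral>\<^sup>+x. norm (g x * cnj (CLINT y|lborel. g y * of_real (G (x - y)))) \<partial>lborel)"
    by (rule ennreal_norm_integral_le)
  also have "\<dots> \<le> (\<integral>\<^sup>+x. (\<integral>\<^sup>+y. ennreal (norm (g x) * (norm (g y) * G (x - y))) \<partial>lborel) \<partial>lborel)"
  proof (rule nn_integral_mono)
    fix x
    have "ennreal (norm (CLINT y|lborel. g y * of_real (G (x - y))))
      \<le> (\<integral>\<^sup>+y. ennreal (norm (g y * of_real (G (x - y)))) \<partial>lborel)"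
      by (rule ennreal_norm_integral_le)
    also have "\<dots> = (\<integral>\<^sup>+y. ennreal (norm (g y) * G (x - y)) \<partial>lborel)"
      by (simp add: norm_mult G_nonneg)
    finally have "ennreal (norm (g x)) * ennreal (norm (CLINT y|lborel. g y * of_real (G (x - y))))
      \<le> ennreal (norm (g x)) * (\<integral>\<^sup>+y. ennreal (norm (g y) * G (x - y)) \<partial>lborel)"
      by (intro mult_left_mono) auto
    then show "ennreal (norm (g x * cnj (CLINT y|lborel. g y * of_real (G (x - y)))))
      \<le> (\<integral>\<^sup>+y. ennreal (norm (g x) * (norm (g y) * G (x - y))) \<partial>lborel)"
      by (simp add: norm_mult ennreal_mult G_nonneg nn_integral_cmult)
  qed
  \<comment> \<open>The inequality 2ab \<le> a^2 + b^2 separates the variables, up to the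
    kernel.\<close>
  also have "\<dots> \<le> (\<integral>\<^sup>+x. (\<integral>\<^sup>+y. ennreal ((norm (g x))\<^sup>2 / 2) * ennreal (G (x - y))
      + ennreal ((norm (g y))\<^sup>2 / 2) * ennreal (G (x - y)) \<partial>lborel) \<partial>lborel)"
  proof (intro nn_integral_mono)
    fix x y
    have "norm (g x) * norm (g y) \<le> (norm (g x))\<^sup>2 / 2 + (norm (g y))\<^sup>2 / 2"
      using sum_squares_bound[of "norm (g x)" "norm (g y)"] by simp
    then have "norm (g x) * (norm (g y) * G (x - y)) \<le> ((norm (g x))\<^sup>2 / 2 + (norm (g y))\<^sup>2 / 2) * G (x - y)"
      using G_nonneg by (simp add: mult.assoc[symmetric] mult_right_mono)
    then show "ennreal (norm (g x) * (norm (g y) * G (x - y))) \<le> ennreal ((norm (g x))\<^sup>2 / 2) * ennreal (G (x - y))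
      + ennreal ((norm (g y))\<^sup>2 / 2) * ennreal (G (x - y))"
      using G_nonneg by (simp add: ennreal_mult[symmetric] ennreal_plus[symmetric] distrib_right ennreal_leI
          del: ennreal_plus)
  qed
  also have "\<dots> = (\<integral>\<^sup>+x. (\<integral>\<^sup>+y. ennreal ((norm (g x))\<^sup>2 / 2) * ennreal (G (x - y)) \<partial>lborel) \<partial>lborel)
      + (\<integral>\<^sup>+x. (\<integral>\<^sup>+y. ennreal ((norm (g y))\<^sup>2 / 2) * ennreal (G (x - y)) \<partial>lborel) \<partial>lborel)"
    by (simp add: nn_integral_add)
  \<comment> \<open>Tonelli and the evenness of \<open>G\<close> make the two summands equal; unit
    mass of \<open>G\<close> then leaves half of the squared norm from each.\<close>
  also have "(\<integral>\<^sup>+x. (\<integral>\<^sup>+y. ennreal ((norm (g y))\<^sup>2 / 2) * ennreal (G (x - y)) \<partial>lborel) \<partial>lborel)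
      = (\<integral>\<^sup>+y. (\<integral>\<^sup>+x. ennreal ((norm (g y))\<^sup>2 / 2) * ennreal (G (y - x)) \<partial>lborel) \<partial>lborel)"
    by (subst lborel_pair.Fubini'[symmetric]) (auto simp: G_even)
  also have "(\<integral>\<^sup>+x. (\<integral>\<^sup>+y. ennreal ((norm (g x))\<^sup>2 / 2) * ennreal (G (x - y)) \<partial>lborel) \<partial>lborel)
      + (\<integral>\<^sup>+y. (\<integral>\<^sup>+x. ennreal ((norm (g y))\<^sup>2 / 2) * ennreal (G (y - x)) \<partial>lborel) \<partial>lborel)
      = (\<integral>\<^sup>+x. ennreal ((norm (g x))\<^sup>2 / 2) + ennreal ((norm (g x))\<^sup>2 / 2) \<partial>lborel)"
    by (simp add: nn_integral_cmult G_int nn_integral_add)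
  also have "\<dots> = (\<integral>\<^sup>+x. ennreal ((norm (g x))\<^sup>2) \<partial>lborel)"
    by (simp add: ennreal_plus[symmetric] del: ennreal_plus)
  finally show ?thesis
    by (simp add: w_def)
qed

text \<open>Monotone convergence: the Gaussian weights increase to 1 with their width. The widths
  \<open>Suc n\<close> are positive, as the damped estimate requires.\<close>

lemma nn_integral_fourier_le:
  fixes g :: "real \<Rightarrow> complex"
  assumes g: "integrable lborel g"
  shows "(\<integral>\<^sup>+\<omega>. ennreal ((norm (fourier g \<omega>))\<^sup>2) \<partial>lborel) \<le> (\<integral>\<^sup>+x. ennreal ((norm (g x))\<^sup>2) \<partial>lborel)"
proof -
  have [measurable]: "g \<in> borel_measurable borel"
    using borel_measurable_integrable[OF g] by auto
  define u where "u = (\<lambda>n \<omega>. ennreal (exp (- \<omega>\<^sup>2 / (2 * (real (Suc n))\<^sup>2)) * (norm (fourier g \<omega>))\<^sup>2))"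
  have "(\<lambda>n. integral\<^sup>N lborel (u n)) \<longlonglongrightarrow> (\<integral>\<^sup>+\<omega>. ennreal ((norm (fourier g \<omega>))\<^sup>2) \<partial>lborel)"
  proof (rule nn_integral_LIMSEQ)
    show "incseq u"
      unfolding u_def incseq_def le_fun_def
      by (intro allI impI ennreal_leI mult_right_mono)
         (auto simp: divide_simps intro!: mult_left_mono power_mono)
    show "u n \<in> borel_measurable lborel" for n
      unfolding u_def by measurable
    fix \<omega>
    have "(\<lambda>n. exp (- \<omega>\<^sup>2 / (2 * (real (Suc n))\<^sup>2))) \<longlonglongrightarrow> 1"
      by real_asymp
    then have "(\<lambda>n. exp (- \<omega>\<^sup>2 / (2 * (real (Suc n))\<^sup>2)) * (norm (fourier g \<omega>))\<^sup>2) \<longlonglongrightarrow> 1 * (norm (fourier g \<omega>))\<^sup>2"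
      by (intro tendsto_intros)
    then show "(\<lambda>n. u n \<omega>) \<longlonglongrightarrow> ennreal ((norm (fourier g \<omega>))\<^sup>2)"
      unfolding u_def by (intro tendsto_ennrealI) simp
  qed
  then show ?thesis
    by (rule LIMSEQ_le_const2)
       (unfold u_def, intro exI allI impI nn_integral_fourier_gaussian_le[OF g], simp)
qed

section \<open>The square integral of the window difference\<close>

lemma nn_integral_square_add_le:
  fixes p q :: "'a \<Rightarrow> real"
  assumes [measurable]: "p \<in> borel_measurable M" "q \<in> borel_measurable M"
    and p0: "\<And>x. 0 \<le> p x" and q0: "\<And>x. 0 \<le> q x"
    and P0: "0 \<le> P" and Q0: "0 \<le> Q"
    and P: "(\<integral>\<^sup>+x. ennreal ((p x)\<^sup>2) \<partial>M) \<le> ennreal (P\<^sup>2)"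
    and Q: "(\<integral>\<^sup>+x. ennreal ((q x)\<^sup>2) \<partial>M) \<le> ennreal (Q\<^sup>2)"
  shows "(\<integral>\<^sup>+x. ennreal ((p x + q x)\<^sup>2) \<partial>M) \<le> ennreal ((P + Q)\<^sup>2)"
proof -
  \<comment> \<open>This is Minkowski's inequality in squared form: Cauchy-Schwarz bounds the cross
    term by \<open>P * Q\<close>.\<close>
  have "(\<integral>\<^sup>+x. ennreal (p x) * ennreal (q x) \<partial>M)\<^sup>2
      \<le> (\<integral>\<^sup>+x. (ennreal (p x))\<^sup>2 \<partial>M) * (\<integral>\<^sup>+x. (ennreal (q x))\<^sup>2 \<partial>M)"
    by (rule Cauchy_Schwarz_nn_integral) auto
  also have "\<dots> \<le> ennreal (P\<^sup>2) * ennreal (Q\<^sup>2)"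
    using P Q by (intro mult_mono) (auto simp: ennreal_power p0 q0)
  also have "\<dots> = (ennreal (P * Q))\<^sup>2"
    using P0 Q0 by (simp add: ennreal_mult[symmetric] ennreal_power power_mult_distrib)
  finally have sq: "(\<integral>\<^sup>+x. ennreal (p x) * ennreal (q x) \<partial>M)\<^sup>2 \<le> (ennreal (P * Q))\<^sup>2" .
  have pq: "(\<integral>\<^sup>+x. ennreal (p x * q x) \<partial>M) \<le> ennreal (P * Q)"
  proof (cases "\<integral>\<^sup>+x. ennreal (p x) * ennreal (q x) \<partial>M")
    case (real r)
    with sq have "r\<^sup>2 \<le> (P * Q)\<^sup>2"
      using P0 Q0 by (simp add: ennreal_power)
    then have "r \<le> P * Q"
      using P0 Q0 by (intro power2_le_imp_le[of r]) auto
    with real show ?thesis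
      by (simp add: ennreal_mult p0 q0 ennreal_leI)
  next
    \<comment> \<open>An infinite cross term would have infinite square, contradicting the finite
      bound \<open>sq\<close>.\<close>
    case top
    with sq P0 Q0 show ?thesis
      by (simp add: ennreal_power top_power_ennreal top_unique)
  qed
  have "(\<integral>\<^sup>+x. ennreal ((p x + q x)\<^sup>2) \<partial>M)
      = (\<integral>\<^sup>+x. ennreal ((p x)\<^sup>2) + ennreal ((q x)\<^sup>2) + 2 * ennreal (p x * q x) \<partial>M)"
  proof (rule nn_integral_cong)
    fix x
    have "ennreal ((p x + q x)\<^sup>2) = ennreal ((p x)\<^sup>2 + (q x)\<^sup>2 + 2 * (p x * q x))"
      by (simp add: power2_sum mult.assoc)
    then show "ennreal ((p x + q x)\<^sup>2) = ennreal ((p x)\<^sup>2) + ennreal ((q x)\<^sup>2) + 2 * ennreal (p x * q x)"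
      using p0 q0 by (simp add: ennreal_plus ennreal_mult)
  qed
  also have "\<dots> = (\<integral>\<^sup>+x. ennreal ((p x)\<^sup>2) \<partial>M) + (\<integral>\<^sup>+x. ennreal ((q x)\<^sup>2) \<partial>M)
      + 2 * (\<integral>\<^sup>+x. ennreal (p x * q x) \<partial>M)"
    by (simp add: nn_integral_add nn_integral_cmult)
  also have "\<dots> \<le> ennreal (P\<^sup>2) + ennreal (Q\<^sup>2) + 2 * ennreal (P * Q)"
    by (intro add_mono mult_left_mono P Q pq) auto
  also have "\<dots> = ennreal (P\<^sup>2 + Q\<^sup>2 + 2 * (P * Q))"
    using P0 Q0 by (simp add: ennreal_plus ennreal_mult)
  also have "P\<^sup>2 + Q\<^sup>2 + 2 * (P * Q) = (P + Q)\<^sup>2"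
    by (simp add: power2_sum)
  finally show ?thesis .
qed

text \<open>In the application \<open>s\<close> and \<open>s'\<close> vary with time. The bound
  therefore involves them only through \<open>m\<close>, \<open>S\<close> and \<epsilon>, so that it
  is a fixed function of \<open>u\<close>, square integrable on the line.\<close>

lemma norm_dilation_diff_le:
  fixes h :: "real \<Rightarrow> complex"
  assumes m: "0 < m" and s: "m \<le> s" "s \<le> S" and s': "m \<le> s'" and e: "\<bar>s' - s\<bar> \<le> \<epsilon>"
    and h_le: "\<And>t. norm (h t) \<le> \<Psi> / (1 + \<bar>t\<bar>)"
    and h': "\<And>t. (h has_vector_derivative h' t) (at t)"
    and h'_le: "\<And>t. norm (h' t) \<le> \<Phi> / (1 + t\<^sup>2)"
  shows "norm (of_real (sqrt s') * h (s' * u) - of_real (sqrt s) * h (s * u))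
    \<le> \<epsilon> * \<Psi> / (2 * sqrt m) * (1 / (1 + m * \<bar>u\<bar>)) + \<epsilon> * sqrt S * \<Phi> * (\<bar>u\<bar> / (1 + m\<^sup>2 * u\<^sup>2))"
proof -
  have \<Psi>: "0 \<le> \<Psi>" using h_le[of 0] norm_ge_zero[of "h 0"] by (simp del: norm_ge_zero)
  have \<Phi>: "0 \<le> \<Phi>" using h'_le[of 0] norm_ge_zero[of "h' 0"] by (simp del: norm_ge_zero)
  have \<epsilon>: "0 \<le> \<epsilon>" using e by simp
  \<comment> \<open>The difference of roots is multiplied by the sum of roots, which is at least
    \<open>2 * sqrt m\<close>.\<close>
  have "\<bar>sqrt s' - sqrt s\<bar> * (2 * sqrt m) \<le> \<bar>sqrt s' - sqrt s\<bar> * (sqrt s' + sqrt s)"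
    using real_sqrt_le_mono[OF s(1)] real_sqrt_le_mono[OF s']
    by (intro mult_left_mono abs_ge_zero) linarith
  also have "\<dots> = \<bar>(sqrt s' - sqrt s) * (sqrt s' + sqrt s)\<bar>"
    using m s s' by (simp add: abs_mult)
  also have "\<dots> = \<bar>s' - s\<bar>"
    using m s s' by (simp add: algebra_simps)
  finally have sqrt_le: "\<bar>sqrt s' - sqrt s\<bar> \<le> \<epsilon> / (2 * sqrt m)"
    using e m by (simp add: pos_le_divide_eq)
  have "\<Psi> / (1 + \<bar>s' * u\<bar>) \<le> \<Psi> * (1 / (1 + m * \<bar>u\<bar>))"
    using \<Psi> m s' by (auto simp: abs_mult intro!: divide_left_mono mult_right_mono mult_pos_pos add_pos_nonneg)
  with h_le[of "s' * u"] have h_u: "norm (h (s' * u)) \<le> \<Psi> * (1 / (1 + m * \<bar>u\<bar>))"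
    by linarith
  \<comment> \<open>Each point of the segment is \<open>u\<close> times a convex combination of
    \<open>s\<close> and \<open>s'\<close>, hence at least \<open>m * \<bar>u\<bar>\<close> in
    modulus; the decay of \<open>h'\<close> is thus uniform along the segment.\<close>
  have h'_bound: "norm (h' \<xi>) \<le> \<Phi> / (1 + m\<^sup>2 * u\<^sup>2)" if seg: "\<xi> \<in> closed_segment (s * u) (s' * u)" for \<xi>
  proof -
    obtain r where r: "0 \<le> r" "r \<le> 1" and \<xi>: "\<xi> = (1 - r) *\<^sub>R (s * u) + r *\<^sub>R (s' * u)"
      using seg by (auto simp: in_segment)
    have "(1 - r) * m + r * m \<le> (1 - r) * s + r * s'"
      using r s s' by (intro add_mono mult_left_mono) auto
    then have "m \<le> (1 - r) * s + r * s'"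
      by (simp add: algebra_simps)
    moreover have "\<xi> = ((1 - r) * s + r * s') * u"
      by (simp add: \<xi> algebra_simps)
    ultimately have "m\<^sup>2 * u\<^sup>2 \<le> \<xi>\<^sup>2"
      using m by (simp add: power_mult_distrib mult_right_mono power_mono)
    then have "\<Phi> / (1 + \<xi>\<^sup>2) \<le> \<Phi> / (1 + m\<^sup>2 * u\<^sup>2)"
      using \<Phi> by (intro divide_left_mono mult_pos_pos add_pos_nonneg) auto
    with h'_le[of \<xi>] show ?thesis by linarith
  qed
  \<comment> \<open>The length of the segment contributes the factor \<open>\<bar>u\<bar>\<close>
    that appears in the second summand.\<close>
  have "norm (h (s' * u) - h (s * u)) \<le> \<Phi> / (1 + m\<^sup>2 * u\<^sup>2) * norm (s' * u - s * u)"
  proof (rule differentiable_bound[where S = "closed_segment (s * u) (s' * u)" and f' = "\<lambda>t x. x *\<^sub>R h' t"])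
    show "(h has_derivative (\<lambda>x. x *\<^sub>R h' \<xi>)) (at \<xi> within closed_segment (s * u) (s' * u))" for \<xi>
      using h'[of \<xi>] by (auto simp: has_vector_derivative_def intro: has_derivative_at_withinI)
    show "onorm (\<lambda>x. x *\<^sub>R h' \<xi>) \<le> \<Phi> / (1 + m\<^sup>2 * u\<^sup>2)" if "\<xi> \<in> closed_segment (s * u) (s' * u)" for \<xi>
      using h'_bound[OF that] by (simp add: onorm_scaleR_left onorm_id[where 'a = real, unfolded id_def] bounded_linear_ident)
  qed auto
  also have "\<dots> \<le> \<Phi> / (1 + m\<^sup>2 * u\<^sup>2) * (\<epsilon> * \<bar>u\<bar>)"
    using e \<Phi> by (intro mult_left_mono)
      (auto simp: left_diff_distrib[symmetric] abs_mult intro!: mult_right_mono divide_nonneg_pos add_pos_nonneg)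
  finally have h_diff: "norm (h (s' * u) - h (s * u)) \<le> \<epsilon> * \<Phi> * (\<bar>u\<bar> / (1 + m\<^sup>2 * u\<^sup>2))"
    by (simp add: ac_simps)
  have "of_real (sqrt s') * h (s' * u) - of_real (sqrt s) * h (s * u)
    = of_real (sqrt s' - sqrt s) * h (s' * u) + of_real (sqrt s) * (h (s' * u) - h (s * u))"
    by (simp add: algebra_simps)
  also have "norm \<dots> \<le> \<bar>sqrt s' - sqrt s\<bar> * norm (h (s' * u)) + sqrt s * norm (h (s' * u) - h (s * u))"
    using m s by (intro norm_triangle_le) (simp add: norm_mult del: of_real_diff)
  also have "\<dots> \<le> \<epsilon> / (2 * sqrt m) * (\<Psi> * (1 / (1 + m * \<bar>u\<bar>)))
      + sqrt S * (\<epsilon> * \<Phi> * (\<bar>u\<bar> / (1 + m\<^sup>2 * u\<^sup>2)))"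
    using m s \<epsilon> sqrt_le h_u h_diff by (intro add_mono mult_mono) auto
  finally show ?thesis
    by (simp add: ac_simps)
qed

text \<open>Since the dilation factors depend on t, rescaling the variable inside \<open>h\<close>
  is not a linear substitution. The uniform pointwise bound depends on \<open>x - t\<close> alone,
  so a reflection removes \<open>x\<close> and leaves the two explicit integrals.\<close>

lemma nn_integral_dilation_diff_le:
  fixes h :: "real \<Rightarrow> complex" and \<sigma> \<tau> :: "real \<Rightarrow> real"
  assumes m: "0 < m" and \<sigma>: "\<And>t. m \<le> \<sigma> t" "\<And>t. \<sigma> t \<le> S" and \<tau>: "\<And>t. m \<le> \<tau> t"
    and e: "\<And>t. \<bar>\<tau> t - \<sigma> t\<bar> \<le> \<epsilon>"
    and h_le: "\<And>t. norm (h t) \<le> \<Psi> / (1 + \<bar>t\<bar>)"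
    and h': "\<And>t. (h has_vector_derivative h' t) (at t)"
    and h'_le: "\<And>t. norm (h' t) \<le> \<Phi> / (1 + t\<^sup>2)"
  shows "(\<integral>\<^sup>+t. ennreal ((norm (of_real (sqrt (\<tau> t)) * h (\<tau> t * (x - t))
      - of_real (sqrt (\<sigma> t)) * h (\<sigma> t * (x - t))))\<^sup>2) \<partial>lborel)
    \<le> ennreal ((\<epsilon> * (sqrt 2 / 2 * (\<Psi> / m) + sqrt (pi / 2) * (\<Phi> / m powr (3 / 2)) * S powr (1 / 2)))\<^sup>2)"
proof -
  have \<Psi>: "0 \<le> \<Psi>" using h_le[of 0] norm_ge_zero[of "h 0"] by (simp del: norm_ge_zero)
  have \<Phi>: "0 \<le> \<Phi>" using h'_le[of 0] norm_ge_zero[of "h' 0"] by (simp del: norm_ge_zero)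
  have \<epsilon>: "0 \<le> \<epsilon>" using e[of 0] by simp
  have S: "0 \<le> S" using \<sigma>[of 0] m by simp
  define p where "p u = \<epsilon> * \<Psi> / (2 * sqrt m) * (1 / (1 + m * \<bar>u\<bar>))" for u
  define q where "q u = \<epsilon> * sqrt S * \<Phi> * (\<bar>u\<bar> / (1 + m\<^sup>2 * u\<^sup>2))" for u
  define P where "P = \<epsilon> * (sqrt 2 / 2 * (\<Psi> / m))"
  define Q where "Q = \<epsilon> * (sqrt (pi / 2) * (\<Phi> / m powr (3 / 2)) * S powr (1 / 2))"
  have [measurable]: "p \<in> borel_measurable borel" "q \<in> borel_measurable borel"
    unfolding p_def[abs_def] q_def[abs_def] by measurable
  have "(\<integral>\<^sup>+t. ennreal ((norm (of_real (sqrt (\<tau> t)) * h (\<tau> t * (x - t))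
      - of_real (sqrt (\<sigma> t)) * h (\<sigma> t * (x - t))))\<^sup>2) \<partial>lborel)
    \<le> (\<integral>\<^sup>+t. ennreal ((p (x - t) + q (x - t))\<^sup>2) \<partial>lborel)"
    unfolding p_def q_def
    by (intro nn_integral_mono ennreal_leI power_mono norm_dilation_diff_le[OF m _ _ _ _ h_le h' h'_le] \<sigma> \<tau> e) auto
  also have "\<dots> = (\<integral>\<^sup>+u. ennreal ((p u + q u)\<^sup>2) \<partial>lborel)"
    by (rule nn_integral_lborel_reflect) measurable
  also have "\<dots> \<le> ennreal ((P + Q)\<^sup>2)"
  proof (rule nn_integral_square_add_le)
    show "0 \<le> p u" "0 \<le> q u" for u
      using m \<Psi> \<Phi> \<epsilon> S by (auto simp: p_def q_def)
    show "0 \<le> P" "0 \<le> Q"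
      using m \<Psi> \<Phi> \<epsilon> by (auto simp: P_def Q_def)
    have "(\<integral>\<^sup>+u. ennreal ((p u)\<^sup>2) \<partial>lborel)
        = ennreal ((\<epsilon> * \<Psi> / (2 * sqrt m))\<^sup>2) * (\<integral>\<^sup>+u. ennreal ((1 / (1 + m * \<bar>u\<bar>))\<^sup>2) \<partial>lborel)"
      unfolding p_def power_mult_distrib[of "\<epsilon> * \<Psi> / (2 * sqrt m)"]
      by (simp add: ennreal_mult nn_integral_cmult)
    also have "\<dots> = ennreal ((\<epsilon> * \<Psi> / (2 * sqrt m))\<^sup>2 * (2 / m))"
      using m by (simp only: nn_integral_inverse_abs_square) (simp add: ennreal_mult del: times_divide_eq_right)
    \<comment> \<open>Both sides are
      \<open>\<epsilon>\<^sup>2 * \<Psi>\<^sup>2 / (2 * m\<^sup>2)\<close>, which explains the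
      factor \<open>sqrt 2 / 2\<close>.\<close>
    also have "(\<epsilon> * \<Psi> / (2 * sqrt m))\<^sup>2 * (2 / m) = P\<^sup>2"
      using m by (simp add: P_def power_divide power_mult_distrib power2_eq_square field_simps)
    finally show "(\<integral>\<^sup>+u. ennreal ((p u)\<^sup>2) \<partial>lborel) \<le> ennreal (P\<^sup>2)" by simp
    have "(\<integral>\<^sup>+u. ennreal ((q u)\<^sup>2) \<partial>lborel)
        = ennreal ((\<epsilon> * sqrt S * \<Phi>)\<^sup>2) * (\<integral>\<^sup>+u. ennreal ((\<bar>u\<bar> / (1 + m\<^sup>2 * u\<^sup>2))\<^sup>2) \<partial>lborel)"
      unfolding q_def power_mult_distrib[of "\<epsilon> * sqrt S * \<Phi>"]
      by (simp add: ennreal_mult nn_integral_cmult)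
    also have "\<dots> = ennreal ((\<epsilon> * sqrt S * \<Phi>)\<^sup>2 * (pi / (2 * m ^ 3)))"
      using m by (simp only: nn_integral_abs_over_quadratic_square) (simp add: ennreal_mult del: times_divide_eq_right)
    also have "(\<epsilon> * sqrt S * \<Phi>)\<^sup>2 * (pi / (2 * m ^ 3)) = Q\<^sup>2"
    proof -
      have "(m powr (3 / 2))\<^sup>2 = m ^ 3"
        using m by (simp add: powr_power)
      moreover have "(S powr (1 / 2))\<^sup>2 = S"
        using S by (simp add: powr_half_sqrt)
      ultimately show ?thesis
        using S by (simp add: Q_def power_mult_distrib power_divide)
    qed
    finally show "(\<integral>\<^sup>+u. ennreal ((q u)\<^sup>2) \<partial>lborel) \<le> ennreal (Q\<^sup>2)" by simp
  qed measurable
  also have "P + Q = \<epsilon> * (sqrt 2 / 2 * (\<Psi> / m) + sqrt (pi / 2) * (\<Phi> / m powr (3 / 2)) * S powr (1 / 2))"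
    by (simp add: P_def Q_def distrib_left)
  finally show ?thesis .
qed

section \<open>The focus transform as a Fourier transform\<close>

lemma integrable_mult_dilation:
  fixes g h :: "real \<Rightarrow> complex"
  assumes [measurable]: "g \<in> borel_measurable borel" "h \<in> borel_measurable borel"
    and g2: "integrable lborel (\<lambda>x. (norm (g x))\<^sup>2)"
    and h_le: "\<And>t. norm (h t) \<le> \<Psi> / (1 + \<bar>t\<bar>)"
    and s: "0 < s"
  shows "integrable lborel (\<lambda>x. g x * cnj (h (s * (x - t))))"
proof (rule Bochner_Integration.integrable_bound)
  \<comment> \<open>The assumed decay of \<open>h\<close> makes the window square integrable, not
    necessarily integrable; the product is dominated by the sum of two integrable squares.\<close>
  let ?q = "\<lambda>x. (1 / (1 + s * \<bar>x - t\<bar>))\<^sup>2"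
  have "integrable lborel ?q"
  proof (rule integrableI_bounded)
    have "(\<integral>\<^sup>+x. norm (?q x) \<partial>lborel) = (\<integral>\<^sup>+x. ennreal ((1 / (1 + s * \<bar>t - x\<bar>))\<^sup>2) \<partial>lborel)"
      by (simp add: abs_minus_commute)
    also have "\<dots> = (\<integral>\<^sup>+x. ennreal ((1 / (1 + s * \<bar>x\<bar>))\<^sup>2) \<partial>lborel)"
      by (rule nn_integral_lborel_reflect) measurable
    also have "\<dots> = ennreal (2 / s)"
      by (rule nn_integral_inverse_abs_square[OF s])
    finally show "(\<integral>\<^sup>+x. norm (?q x) \<partial>lborel) < \<infinity>" by simp
  qed measurable
  then show "integrable lborel (\<lambda>x. (norm (g x))\<^sup>2 + \<Psi>\<^sup>2 * ?q x)"
    using g2 by (intro Bochner_Integration.integrable_add integrable_mult_right) auto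
  show "AE x in lborel. norm (g x * cnj (h (s * (x - t)))) \<le> norm ((norm (g x))\<^sup>2 + \<Psi>\<^sup>2 * ?q x)"
  proof (intro AE_I2)
    fix x
    let ?h = "norm (h (s * (x - t)))"
    have "?h \<le> \<Psi> * (1 / (1 + s * \<bar>x - t\<bar>))"
      using h_le[of "s * (x - t)"] s by (simp add: abs_mult)
    then have "?h\<^sup>2 \<le> \<Psi>\<^sup>2 * ?q x"
      unfolding power_mult_distrib[symmetric] by (rule power_mono) simp
    moreover have "norm (g x) * ?h \<le> (norm (g x))\<^sup>2 + ?h\<^sup>2"
      using sum_squares_bound[of "norm (g x)" ?h] mult_nonneg_nonneg[OF norm_ge_zero norm_ge_zero, of "g x" "h (s * (x - t))"]
      by linarith
    ultimately have "norm (g x) * ?h \<le> (norm (g x))\<^sup>2 + \<Psi>\<^sup>2 * ?q x"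
      by linarith
    then show "norm (g x * cnj (h (s * (x - t)))) \<le> norm ((norm (g x))\<^sup>2 + \<Psi>\<^sup>2 * ?q x)"
      unfolding norm_mult complex_mod_cnj real_norm_def by (rule order_trans[OF _ abs_ge_self])
  qed
qed measurable

text \<open>Conjugating the atom turns its modulation into the Fourier kernel. Replacing
  \<open>f\<close> by the Borel representative \<open>g\<close> makes the integrand Borel, so that
  its Lebesgue and Borel integrals agree.\<close>

lemma focus_transform_eq_fourier:
  assumes f: "f \<in> borel_measurable lebesgue" and g: "g \<in> borel_measurable borel"
    and fg: "AE x in lborel. f x = g x"
    and [measurable]: "h \<in> borel_measurable borel"
  shows "focus_transform h s f t \<omega> = fourier (\<lambda>x. g x * cnj (of_real (sqrt (s t)) * h (s t * (x - t)))) \<omega>"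
proof -
  have "(\<lambda>x. focus_atom h s t \<omega> x) \<in> borel_measurable borel"
    unfolding focus_atom_def by measurable
  then have atom: "(\<lambda>x. cnj (focus_atom h s t \<omega> x)) \<in> borel_measurable borel"
    by measurable
  have atom_g: "(\<lambda>x. g x * cnj (focus_atom h s t \<omega> x)) \<in> borel_measurable lborel"
    using atom g by measurable
  have "focus_transform h s f t \<omega> = (CLINT x|lebesgue. g x * cnj (focus_atom h s t \<omega> x))"
    unfolding focus_transform_def L2_inner_def
  proof (rule integral_cong_AE)
    show "(\<lambda>x. f x * cnj (focus_atom h s t \<omega> x)) \<in> borel_measurable lebesgue"
      by (rule borel_measurable_times[OF f measurable_completion]) (use atom in simp)
    show "(\<lambda>x. g x * cnj (focus_atom h s t \<omega> x)) \<in> borel_measurable lebesgue"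
      using atom_g by (rule measurable_completion)
    show "AE x in lebesgue. f x * cnj (focus_atom h s t \<omega> x) = g x * cnj (focus_atom h s t \<omega> x)"
      using AE_completion[OF fg] by auto
  qed
  also have "\<dots> = (CLINT x|lborel. g x * cnj (focus_atom h s t \<omega> x))"
    using atom_g by (rule integral_completion)
  also have "\<dots> = fourier (\<lambda>x. g x * cnj (of_real (sqrt (s t)) * h (s t * (x - t)))) \<omega>"
    unfolding fourier_def
    by (intro Bochner_Integration.integral_cong) (simp_all add: focus_atom_def exp_cnj ac_simps)
  finally show ?thesis .
qed

lemma fourier_diff:
  assumes u: "integrable lborel u" and v: "integrable lborel v"
  shows "fourier (\<lambda>x. u x - v x) \<omega> = fourier u \<omega> - fourier v \<omega>"
proof -
  have "integrable lborel (\<lambda>x. k x * iexp (- (2 * pi * \<omega> * x)))" if k: "integrable lborel k" for k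
    by (rule Bochner_Integration.integrable_bound[OF k])
       (use borel_measurable_integrable[OF k] in \<open>auto simp: norm_mult\<close>)
  with u v show ?thesis
    unfolding fourier_def by (simp only: left_diff_distrib Bochner_Integration.integral_diff)
qed

section \<open>The estimate on the time-frequency plane\<close>

theorem corollary1:
  fixes \<sigma>min \<epsilon> :: real
    and h f :: "real \<Rightarrow> complex"
    and \<psi> \<phi> \<sigma>\<epsilon> :: "real \<Rightarrow> real"
    and focus :: "(real \<Rightarrow> complex) \<Rightarrow> real \<Rightarrow> real"
  assumes "0 < \<sigma>min" "\<sigma>min < 1"
    and "h C1_differentiable_on UNIV"
    and "continuous_on UNIV \<psi>" "\<And>t. 0 \<le> \<psi> t" "bounded (range \<psi>)"
    and "continuous_on UNIV \<phi>" "\<And>t. 0 \<le> \<phi> t" "bounded (range \<phi>)"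
    and "\<And>t. cmod (h t) \<le> \<psi> t / (1 + \<bar>t\<bar>)"
    and "\<And>t. cmod (vector_derivative h (at t)) \<le> \<phi> t / (1 + t\<^sup>2)"
    and "\<And>g. g \<in> L2_space lebesgue \<Longrightarrow> focus g \<in> focus_class \<sigma>min"
    and "f \<in> L2_space lebesgue"
    and "0 < \<epsilon>"
    and "\<sigma>\<epsilon> \<in> focus_class \<sigma>min"
    and "Linf_norm (\<lambda>t. focus f t - \<sigma>\<epsilon> t) \<le> \<epsilon>"
  defines "D \<equiv> \<lambda>(t, \<omega>). focus_transform h \<sigma>\<epsilon> f t \<omega> - nonlinear_focus_transform h focus f t \<omega>"
  shows "D \<in> L2_space (lebesgue :: (real \<times> real) measure) \<and>
         L2_norm (lebesgue :: (real \<times> real) measure) D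
           \<le> \<epsilon> * C1_const \<sigma>min \<psi> \<phi> (focus f) * L2_norm lebesgue f"
proof -
  define m \<sigma> \<tau> where "m = \<sigma>min" and "\<sigma> = focus f" and "\<tau> = \<sigma>\<epsilon>"
  define \<Psi> \<Phi> S where "\<Psi> = Linf_norm \<psi>" and "\<Phi> = Linf_norm \<phi>" and "S = Linf_norm \<sigma>"
  define K where "K = \<epsilon> * C1_const \<sigma>min \<psi> \<phi> \<sigma>"
  have m: "0 < m"
    using assms by (simp add: m_def)
  have focus_cls: "\<sigma> \<in> focus_class m" "\<tau> \<in> focus_class m"
    using assms by (auto simp: \<sigma>_def \<tau>_def m_def)
  then have cont: "continuous_on UNIV \<sigma>" "continuous_on UNIV \<tau>"
    and ge: "m \<le> \<sigma> t" "m \<le> \<tau> t" for t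
    by (auto simp: focus_class_def)
  note bdd = focus_cls[THEN bounded_range_focus_class]
  have \<sigma>_le: "\<sigma> t \<le> S" for t
    using abs_le_Linf_norm[OF cont(1) bdd(1), of t] by (simp add: S_def)
  have close: "\<bar>\<tau> t - \<sigma> t\<bar> \<le> \<epsilon>" for t
  proof -
    \<comment> \<open>Boundedness comes first: only then does the hypothesis on
      \<open>Linf_norm\<close> control the difference pointwise.\<close>
    have "bounded (range (\<lambda>t. \<sigma> t - \<tau> t))"
      using bdd by (intro bounded_minus_comp) auto
    then have "\<bar>\<sigma> t - \<tau> t\<bar> \<le> Linf_norm (\<lambda>t. \<sigma> t - \<tau> t)"
      using cont by (intro abs_le_Linf_norm continuous_intros)
    then show ?thesis
      using assms(16) by (simp add: \<sigma>_def \<tau>_def)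
  qed
  have h_le: "cmod (h t) \<le> \<Psi> / (1 + \<bar>t\<bar>)" for t
  proof -
    have "\<psi> t \<le> \<Psi>"
      using abs_le_Linf_norm[OF assms(4,6), of t] by (simp add: \<Psi>_def)
    then show ?thesis
      by (intro order_trans[OF assms(10)] divide_right_mono) auto
  qed
  have h': "(h has_vector_derivative vector_derivative h (at t)) (at t)" for t
    using assms(3) by (simp add: C1_differentiable_on_eq vector_derivative_works)
  have h'_le: "cmod (vector_derivative h (at t)) \<le> \<Phi> / (1 + t\<^sup>2)" for t
  proof -
    have "\<phi> t \<le> \<Phi>"
      using abs_le_Linf_norm[OF assms(7,9), of t] by (simp add: \<Phi>_def)
    then show ?thesis
      by (intro order_trans[OF assms(11)] divide_right_mono) auto
  qed
  have [measurable]: "h \<in> borel_measurable borel" "\<sigma> \<in> borel_measurable borel" "\<tau> \<in> borel_measurable borel"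
    using assms(3) cont
    by (auto intro!: borel_measurable_continuous_onI C1_differentiable_imp_continuous_on)

  have f: "f \<in> borel_measurable lebesgue" "integrable lebesgue (\<lambda>x. (cmod (f x))\<^sup>2)"
    using assms(13) by (auto simp: L2_space_def)
  obtain g where g[measurable]: "g \<in> borel_measurable borel" and fg: "AE x in lborel. f x = g x"
    using lebesgue_ex_borel_representative[OF f(1)] by blast
  have fg': "AE x in lebesgue. f x = g x"
    using fg by (rule AE_completion)
  have g_lebesgue: "g \<in> borel_measurable lebesgue"
    by (intro measurable_completion) simp
  have "integrable lebesgue (\<lambda>x. (cmod (g x))\<^sup>2)"
    using f(2) by (rule integrable_cong_AE_imp) (use f(1) g_lebesgue fg' in auto)
  then have g2: "integrable lborel (\<lambda>x. (cmod (g x))\<^sup>2)"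
    by (simp add: integrable_completion)
  have norm_f: "L2_norm lebesgue f = sqrt (LINT x|lborel. (cmod (g x))\<^sup>2)"
  proof -
    have "(LINT x|lebesgue. (cmod (f x))\<^sup>2) = (LINT x|lebesgue. (cmod (g x))\<^sup>2)"
      using f(1) g_lebesgue fg' by (intro integral_cong_AE) auto
    then show ?thesis
      by (simp add: L2_norm_def integral_completion)
  qed

  \<comment> \<open>\<open>w\<close> is the dilated window without modulation, which is why
    \<open>a\<close> is independent of \<omega> and a Fourier transform in x remains.\<close>
  define w where "w s t x = complex_of_real (sqrt (s t)) * h (s t * (x - t))" for s t x
  define a where "a t x = w \<tau> t x - w \<sigma> t x" for t x
  have gw_integrable: "integrable lborel (\<lambda>x. g x * cnj (w s t x))" if "m \<le> s t" for s t
  proof -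
    have "0 < s t"
      using m that by simp
    then have "integrable lborel (\<lambda>x. of_real (sqrt (s t)) * (g x * cnj (h (s t * (x - t)))))"
      by (intro integrable_mult_right integrable_mult_dilation[OF _ _ g2 h_le]) auto
    then show ?thesis
      by (simp add: w_def ac_simps)
  qed
  have ga: "g x * cnj (a t x) = g x * cnj (w \<tau> t x) - g x * cnj (w \<sigma> t x)" for t x
    by (simp add: a_def right_diff_distrib)
  have ga_integrable: "integrable lborel (\<lambda>x. g x * cnj (a t x))" for t
    unfolding ga by (intro Bochner_Integration.integrable_diff gw_integrable ge)
  have D: "D (t, \<omega>) = fourier (\<lambda>x. g x * cnj (a t x)) \<omega>" for t \<omega>
    unfolding ga D_def nonlinear_focus_transform_def \<sigma>_def[symmetric] \<tau>_def[symmetric] prod.case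
    by (simp only: fourier_diff gw_integrable ge w_def[symmetric]
        focus_transform_eq_fourier[OF f(1) g fg \<open>h \<in> borel_measurable borel\<close>])

  \<comment> \<open>Joint measurability in time and position serves Tonelli, and it also makes the
    parameter integral \<open>D\<close> Borel on the plane.\<close>
  have a_measurable[measurable]: "(\<lambda>(t, x). a t x) \<in> borel_measurable (borel \<Otimes>\<^sub>M borel)"
    unfolding a_def w_def by measurable
  have "(\<lambda>p. CLINT x|lborel. g x * cnj (a (fst p) x) * iexp (- (2 * pi * snd p * x)))
      \<in> borel_measurable (borel \<Otimes>\<^sub>M borel)"
    by measurable
  moreover have "D = (\<lambda>p. CLINT x|lborel. g x * cnj (a (fst p) x) * iexp (- (2 * pi * snd p * x)))"
    using D by (auto simp: fun_eq_iff fourier_def)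
  ultimately have D_borel[measurable]: "D \<in> borel_measurable (borel \<Otimes>\<^sub>M borel)"
    by simp
  then have D_borel': "D \<in> borel_measurable borel"
    by (simp add: borel_prod)

  \<comment> \<open>The Plancherel inequality acts at fixed t, in the variable \<omega>, whereas the
    window estimate acts at fixed x, in the variable t; Tonelli links the two.\<close>
  have "(\<integral>\<^sup>+p. ennreal ((cmod (D p))\<^sup>2) \<partial>lborel)
      = (\<integral>\<^sup>+t. (\<integral>\<^sup>+\<omega>. ennreal ((cmod (D (t, \<omega>)))\<^sup>2) \<partial>lborel) \<partial>lborel)"
    unfolding lborel_prod[symmetric] by (subst lborel.nn_integral_fst) auto
  also have "\<dots> \<le> (\<integral>\<^sup>+t. (\<integral>\<^sup>+x. ennreal ((cmod (g x * cnj (a t x)))\<^sup>2) \<partial>lborel) \<partial>lborel)"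
    unfolding D by (intro nn_integral_mono nn_integral_fourier_le ga_integrable)
  also have "\<dots> = (\<integral>\<^sup>+x. (\<integral>\<^sup>+t. ennreal ((cmod (g x * cnj (a t x)))\<^sup>2) \<partial>lborel) \<partial>lborel)"
    by (rule lborel_pair.Fubini') measurable
  also have "\<dots> = (\<integral>\<^sup>+x. ennreal ((cmod (g x))\<^sup>2) * (\<integral>\<^sup>+t. ennreal ((cmod (a t x))\<^sup>2) \<partial>lborel) \<partial>lborel)"
    by (simp add: norm_mult power_mult_distrib ennreal_mult nn_integral_cmult)
  also have "\<dots> \<le> (\<integral>\<^sup>+x. ennreal ((cmod (g x))\<^sup>2) * ennreal (K\<^sup>2) \<partial>lborel)"
    unfolding a_def w_def K_def C1_const_def m_def[symmetric] \<Psi>_def[symmetric] \<Phi>_def[symmetric] S_def[symmetric]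
    by (intro nn_integral_mono mult_left_mono nn_integral_dilation_diff_le[OF m ge(1) \<sigma>_le ge(2) close h_le h' h'_le]) auto
  also have "\<dots> = ennreal (LINT x|lborel. (cmod (g x))\<^sup>2) * ennreal (K\<^sup>2)"
    using g2 by (simp add: nn_integral_multc nn_integral_eq_integral)
  also have "\<dots> = ennreal (K\<^sup>2 * (LINT x|lborel. (cmod (g x))\<^sup>2))"
    by (simp add: ennreal_mult mult.commute)
  finally have main: "(\<integral>\<^sup>+p. ennreal ((cmod (D p))\<^sup>2) \<partial>lborel) \<le> ennreal (K\<^sup>2 * (LINT x|lborel. (cmod (g x))\<^sup>2))" .

  \<comment> \<open>The finite bound gives genuine integrability, so the Bochner integral in
    \<open>L2_norm\<close> is not the default value 0.\<close>
  have D_int: "integrable lborel (\<lambda>p. (cmod (D p))\<^sup>2)"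
    using D_borel' main by (intro integrableI_bounded) (auto simp: less_top[symmetric] top_unique)
  then have "D \<in> L2_space lebesgue"
    using D_borel' by (auto simp: L2_space_def integrable_completion intro: measurable_completion)
  moreover have "L2_norm lebesgue D \<le> K * L2_norm lebesgue f"
  proof -
    have "(LINT p|lborel. (cmod (D p))\<^sup>2) \<le> K\<^sup>2 * (LINT x|lborel. (cmod (g x))\<^sup>2)"
      using main D_int by (simp add: nn_integral_eq_integral)
    \<comment> \<open>Taking square roots of the bound with \<open>K\<^sup>2\<close> returns
      \<open>K\<close> only for nonnegative \<open>K\<close>; the signs of the sup-norms are read
      off the decay bounds at 0.\<close>
    moreover have "0 \<le> K"
      using assms(1,14) h_le[of 0] h'_le[of 0] norm_ge_zero[of "h 0"] norm_ge_zero[of "vector_derivative h (at 0)"]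
      by (auto simp: K_def C1_const_def \<Psi>_def \<Phi>_def intro!: mult_nonneg_nonneg add_nonneg_nonneg divide_nonneg_nonneg simp del: norm_ge_zero)
    ultimately have "sqrt (LINT p|lborel. (cmod (D p))\<^sup>2) \<le> K * sqrt (LINT x|lborel. (cmod (g x))\<^sup>2)"
      by (metis real_sqrt_le_mono real_sqrt_mult real_sqrt_unique)
    then show ?thesis
      using D_borel' unfolding norm_f by (simp add: L2_norm_def integral_completion)
  qed
  ultimately show ?thesis
    by (simp add: K_def \<sigma>_def)
qed

end
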